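(* Let $n \ge 1$ be an integer and let $\ell$ be the smallest integer such that $\ell \ge 4$ and $\ell \nmid n$. Then $s_n'((\mathbb{Z}/n\mathbb{Z})^2) = 4n - \ell + 1$.
   Context: A sequence over an abelian group $G$ is a finite sequence of elements of $G$ (repetition allowed); a subsequence is obtained by selecting some of its terms (not necessarily consecutive), and its length is the number of terms selected. A sequence is zero-sum if the sum of its terms is $0$. For a positive integer $k$, the modified Erdős–Ginzburg–Ziv constant $s_k'(G)$ is the smallest integer $L$ such that every zero-sum sequence over $G$ of length at least $L$ contains a zero-sum subsequence of length $k$. *)

theory Defs
  imports "HOL-Algebra.Elementary_Groups" "HOL-Library.Sublist" "HOL-Library.Extended_Nat"
begin

text \<open>
  HOL-Algebra writes abelian groups multiplicatively, so the sum of a sequence is an iterated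
  \<open>\<otimes>\<close> and the zero element is \<open>\<one>\<close>.
\<close>

definition zero_sum :: "('a, 'b) monoid_scheme \<Rightarrow> 'a list \<Rightarrow> bool" where
  "zero_sum G xs \<longleftrightarrow> foldr (\<otimes>\<^bsub>G\<^esub>) xs \<one>\<^bsub>G\<^esub> = \<one>\<^bsub>G\<^esub>"

definition forces_zero_sum :: "('a, 'b) monoid_scheme \<Rightarrow> nat \<Rightarrow> nat \<Rightarrow> bool" where
  "forces_zero_sum G k L \<longleftrightarrow>
    (\<forall>xs. set xs \<subseteq> carrier G \<and> zero_sum G xs \<and> L \<le> length xs \<longrightarrow>
      (\<exists>ys. subseq ys xs \<and> length ys = k \<and> zero_sum G ys))"

text \<open>
  The value is \<open>\<infinity>\<close> if no \<open>L\<close> has the required property; an equation with a finite value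
  therefore includes the existence of such an \<open>L\<close>.
\<close>

definition modified_EGZ :: "('a, 'b) monoid_scheme \<Rightarrow> nat \<Rightarrow> enat" where
  "modified_EGZ G k = (INF L \<in> {L. forces_zero_sum G k L}. enat L)"

end

(*
  Upper bound. Lengths from 4n - 3 on are covered by the Kemnitz conjecture (Reiher's theorem). A
  smaller admissible length is 4n - j with 4 \<le> j < l, so j divides n, say n = jm. Repeatedly
  applying Kemnitz modulo j splits off 4m - 4 zero-sum blocks modulo j of length j. The remaining 3j
  terms again sum to 0 modulo j, and 3j such terms contain one more block. Applying Kemnitz modulo m
  to the 4m - 3 block sums divided by j selects m blocks, that is, jm = n terms.

  Lower bound. With g = max 2 (gcd l n) and l t = - g modulo n, take (t,t), (t+1,t), (t,t+1),
  (t+1,t+1) with multiplicities n + g + 1 - l, n - 1, n - 1, n + 1 - g. A zero-sum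
  subsequence of length n consisting of x0, x1, x2, x3 such terms has x1 + x3 and x2 + x3 in {0, n},
  hence n equal terms, but no multiplicity reaches n because g + 2 \<le> l.
*)

theory Submission
  imports Defs "HOL-Number_Theory.Cong" "HOL-Library.Disjoint_Sets"
begin

section \<open>Alternating sums over subsets and a congruence modulo a prime\<close>

lemma sum_Pow_insert:
  assumes "finite A" "x \<notin> A"
  shows "(\<Sum>I\<in>Pow (insert x A). f I) = (\<Sum>I\<in>Pow A. f I) + (\<Sum>I\<in>Pow A. f (insert x I))"
proof -
  have "inj_on (insert x) (Pow A)"
    using assms(2) by (auto simp: inj_on_def)
  then show ?thesis
    unfolding Pow_insert using assms
    by (subst sum.union_disjoint) (auto simp: sum.reindex)
qed

text \<open>Both sides run over the pairs of a set \<open>I\<close> and an element \<open>i\<close>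
  of it; the right-hand side fixes \<open>i\<close> first and lets \<open>I\<close> stand for the
  rest of the set.\<close>

lemma sum_Pow_sum_swap:
  fixes g :: "'i \<Rightarrow> 'i set \<Rightarrow> int"
  assumes "finite A"
  shows "(\<Sum>I\<in>Pow A. \<Sum>i\<in>I. g i I) = (\<Sum>i\<in>A. \<Sum>I\<in>Pow (A - {i}). g i (insert i I))"
proof -
  have "(\<Sum>I\<in>Pow A. \<Sum>i\<in>I. g i I) = (\<Sum>I\<in>Pow A. \<Sum>i\<in>A. if i \<in> I then g i I else 0)"
  proof (rule sum.cong)
    fix I assume "I \<in> Pow A"
    then have "A \<inter> I = I" by blast
    then show "(\<Sum>i\<in>I. g i I) = (\<Sum>i\<in>A. if i \<in> I then g i I else 0)"
      using sum.inter_restrict[OF assms, of "\<lambda>i. g i I" I] by simp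
  qed simp
  also have "\<dots> = (\<Sum>i\<in>A. \<Sum>I\<in>Pow A. if i \<in> I then g i I else 0)"
    by (rule sum.swap)
  also have "\<dots> = (\<Sum>i\<in>A. \<Sum>I\<in>Pow (A - {i}). g i (insert i I))"
  proof (rule sum.cong)
    fix i assume i: "i \<in> A"
    have "(\<Sum>I\<in>Pow (insert i (A - {i})). if i \<in> I then g i I else 0)
        = (\<Sum>I\<in>Pow (A - {i}). if i \<in> I then g i I else 0) + (\<Sum>I\<in>Pow (A - {i}). g i (insert i I))"
      using assms by (subst sum_Pow_insert) auto
    moreover have "(\<Sum>I\<in>Pow (A - {i}). if i \<in> I then g i I else 0) = 0"
      by (intro sum.neutral) auto
    ultimately show "(\<Sum>I\<in>Pow A. if i \<in> I then g i I else 0) = (\<Sum>I\<in>Pow (A - {i}). g i (insert i I))"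
      using i by (simp add: insert_absorb)
  qed simp
  finally show ?thesis .
qed

text \<open>
  A polynomial of degree less than \<open>card A\<close> in the indicator variables of the elements of \<open>A\<close> has
  vanishing alternating sum over the cube.
\<close>

lemma alternating_sum_prod_affine_eq_0:
  fixes c :: "'k \<Rightarrow> int" and w :: "'k \<Rightarrow> 'i \<Rightarrow> int"
  assumes "finite K" "finite A" "card K < card A"
  shows "(\<Sum>I\<in>Pow A. (-1) ^ card I * (\<Prod>k\<in>K. c k + (\<Sum>i\<in>I. w k i))) = 0"
  using assms
proof (induction K arbitrary: A c rule: finite_induct)
  case empty
  then obtain x where x: "x \<in> A" by fastforce
  define B where "B = A - {x}"
  have A: "A = insert x B" "x \<notin> B" "finite B"
    using x empty by (auto simp: B_def)
  \<comment> \<open>Adding \<open>x\<close> flips the sign, so the two halves of the power set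
    cancel.\<close>
  have "(\<Sum>I\<in>Pow B. (-1::int) ^ card (insert x I)) = (\<Sum>I\<in>Pow B. - ((-1) ^ card I))"
  proof (rule sum.cong)
    fix I assume "I \<in> Pow B"
    then have "finite I" "x \<notin> I" using A finite_subset by auto
    then show "(-1::int) ^ card (insert x I) = - ((-1) ^ card I)" by simp
  qed simp
  then show ?case
    unfolding A(1) using A by (simp add: sum_Pow_insert sum_negf)
next
  case (insert k K)
  define F where "F I = (\<Prod>k\<in>K. c k + (\<Sum>i\<in>I. w k i))" for I
  have less: "card K < card A" using insert by simp
  have "(\<Sum>I\<in>Pow A. (-1) ^ card I * (\<Prod>k\<in>insert k K. c k + (\<Sum>i\<in>I. w k i)))
      = (\<Sum>I\<in>Pow A. c k * ((-1) ^ card I * F I) + (\<Sum>i\<in>I. w k i * ((-1) ^ card I * F I)))"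
  proof (rule sum.cong)
    fix I
    have "(\<Prod>k\<in>insert k K. c k + (\<Sum>i\<in>I. w k i)) = (c k + (\<Sum>i\<in>I. w k i)) * F I"
      using insert.hyps by (simp add: F_def)
    then have "(-1) ^ card I * (\<Prod>k\<in>insert k K. c k + (\<Sum>i\<in>I. w k i))
        = c k * ((-1) ^ card I * F I) + (\<Sum>i\<in>I. w k i) * ((-1) ^ card I * F I)"
      by (simp only: algebra_simps)
    then show "(-1) ^ card I * (\<Prod>k\<in>insert k K. c k + (\<Sum>i\<in>I. w k i))
        = c k * ((-1) ^ card I * F I) + (\<Sum>i\<in>I. w k i * ((-1) ^ card I * F I))"
      by (simp only: sum_distrib_right)
  qed simp
  also have "\<dots> = c k * (\<Sum>I\<in>Pow A. (-1) ^ card I * F I)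
      + (\<Sum>i\<in>A. \<Sum>I\<in>Pow (A - {i}). w k i * ((-1) ^ card (insert i I) * F (insert i I)))"
    by (simp only: sum.distrib sum_distrib_left sum_Pow_sum_swap[OF insert.prems(1)])
  also have "(\<Sum>I\<in>Pow A. (-1) ^ card I * F I) = 0"
    unfolding F_def using insert.IH[OF insert.prems(1) less] .
  also have "(\<Sum>i\<in>A. \<Sum>I\<in>Pow (A - {i}). w k i * ((-1) ^ card (insert i I) * F (insert i I))) = 0"
  proof (rule sum.neutral, rule ballI)
    fix i assume i: "i \<in> A"
    \<comment> \<open>Removing \<open>i\<close> flips the sign and shifts each constant to
      \<open>c k + w k i\<close>, which is why the induction leaves \<open>c\<close> arbitrary;
      \<open>A - {i}\<close> still has more than \<open>card K\<close> elements.\<close>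
    have "(\<Sum>I\<in>Pow (A - {i}). w k i * ((-1) ^ card (insert i I) * F (insert i I)))
        = (\<Sum>I\<in>Pow (A - {i}). - w k i * ((-1) ^ card I * (\<Prod>k\<in>K. (c k + w k i) + (\<Sum>j\<in>I. w k j))))"
    proof (rule sum.cong)
      fix I assume "I \<in> Pow (A - {i})"
      then have "finite I" "i \<notin> I" using insert.prems finite_subset by auto
      then show "w k i * ((-1) ^ card (insert i I) * F (insert i I))
          = - w k i * ((-1) ^ card I * (\<Prod>k\<in>K. (c k + w k i) + (\<Sum>j\<in>I. w k j)))"
        by (simp add: F_def add.assoc)
    qed simp
    also have "\<dots> = - w k i * (\<Sum>I\<in>Pow (A - {i}). (-1) ^ card I * (\<Prod>k\<in>K. (c k + w k i) + (\<Sum>j\<in>I. w k j)))"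
      by (simp only: sum_distrib_left)
    also have "\<dots> = 0"
      using insert.IH[of "A - {i}" "\<lambda>k. c k + w k i"] insert.prems insert.hyps i by simp
    finally show "(\<Sum>I\<in>Pow (A - {i}). w k i * ((-1) ^ card (insert i I) * F (insert i I))) = 0" .
  qed
  finally show ?case by simp
qed

text \<open>
  The product over \<open>j = 1, \<dots>, p - 1\<close> of \<open>j + s\<close> is divisible by \<open>p\<close> exactly if \<open>s\<close> is not, so it
  serves as an indicator modulo \<open>p\<close> of \<open>p dvd s\<close>, up to the factor \<open>fact (p - 1)\<close>.
\<close>

lemma prime_dvd_alternating_count:
  fixes w :: "'t \<Rightarrow> 'i \<Rightarrow> int"
  assumes p: "prime p" and fin: "finite T" "finite A" and less: "card T * (p - 1) < card A"
  shows "int p dvd (\<Sum>I | I \<subseteq> A \<and> (\<forall>t\<in>T. int p dvd sum (w t) I). (-1) ^ card I)"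
proof -
  \<comment> \<open>One affine factor for each condition \<open>t\<close> and each nonzero residue
    \<open>j\<close>, so the degree is \<open>card T * (p - 1)\<close>.\<close>
  define K where "K = T \<times> {1..p - 1}"
  define P where "P I = (\<Prod>k\<in>K. int (snd k) + (\<Sum>i\<in>I. w (fst k) i))" for I
  define G where "G = {I. I \<subseteq> A \<and> (\<forall>t\<in>T. int p dvd sum (w t) I)}"
  define F where "F = (fact (p - 1) :: int) ^ card T"
  have p': "prime (int p)" using p by simp
  have finK: "finite K" "card K < card A"
    using fin less by (simp_all add: K_def)
  have P_good: "[P I = F] (mod int p)" if "I \<in> G" for I
  proof -
    have "[P I = (\<Prod>k\<in>K. int (snd k))] (mod int p)"
      unfolding P_def using that
      by (intro cong_prod) (auto simp: G_def K_def cong_iff_dvd_diff)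
    also have "(\<Prod>k\<in>K. int (snd k)) = (\<Prod>t\<in>T. \<Prod>j = 1..p - 1. int j)"
      by (simp only: K_def prod.cartesian_product case_prod_unfold)
    also have "\<dots> = F"
      by (simp add: F_def fact_prod)
    finally show ?thesis .
  qed
  have P_bad: "int p dvd P I" if I: "I \<notin> G" "I \<subseteq> A" for I
  proof -
    obtain t where t: "t \<in> T" "\<not> int p dvd sum (w t) I"
      using I by (auto simp: G_def)
    \<comment> \<open>This residue is nonzero because \<open>p\<close> does not divide the sum, so
      it indexes one of the factors, and that factor is divisible by \<open>p\<close>.\<close>
    define j where "j = nat (- sum (w t) I mod int p)"
    have p0: "int p > 0" using p prime_gt_0_nat by simp
    have ij: "int j = - sum (w t) I mod int p"
      using p0 by (simp add: j_def)
    have "int j < int p" using p0 by (simp add: ij)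
    moreover have "int j \<noteq> 0"
      using t(2) unfolding ij by (metis dvd_eq_mod_eq_0 dvd_minus_iff)
    ultimately have "(t, j) \<in> K"
      using t(1) by (simp add: K_def)
    moreover have "int p dvd int j + sum (w t) I"
      unfolding ij by (metis add.commute add.right_inverse dvd_0_right mod_add_right_eq mod_0_imp_dvd dvd_imp_mod_0)
    ultimately show ?thesis
      unfolding P_def using finK
      using dvd_prodI[of K "(t, j)" "\<lambda>k. int (snd k) + sum (w (fst k)) I"] dvd_trans by fastforce
  qed
  have "0 = (\<Sum>I\<in>Pow A. (-1) ^ card I * P I)"
    unfolding P_def using alternating_sum_prod_affine_eq_0[OF finK(1) fin(2) finK(2)] by simp
  also have "[\<dots> = (\<Sum>I\<in>Pow A. if I \<in> G then F * (-1) ^ card I else 0)] (mod int p)"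
  proof (rule cong_sum)
    fix I assume I: "I \<in> Pow A"
    show "[(-1) ^ card I * P I = (if I \<in> G then F * (-1) ^ card I else 0)] (mod int p)"
    proof (cases "I \<in> G")
      case True
      have "[(-1) ^ card I * P I = (-1) ^ card I * F] (mod int p)"
        by (rule cong_mult[OF cong_refl P_good[OF True]])
      then show ?thesis using True by (simp only: if_True mult.commute[of F])
    next
      case False
      then show ?thesis using P_bad[OF False] I by (simp add: cong_0_iff)
    qed
  qed
  also have "(\<Sum>I\<in>Pow A. if I \<in> G then F * (-1) ^ card I else 0) = F * (\<Sum>I\<in>G. (-1) ^ card I)"
  proof -
    have "Pow A \<inter> {I. I \<in> G} = G" by (auto simp: G_def)
    then show ?thesis using fin by (simp add: sum.If_cases sum_distrib_left)
  qed
  finally have "int p dvd F * (\<Sum>I\<in>G. (-1) ^ card I)"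
    by (metis cong_0_iff cong_sym)
  moreover have "\<not> int p dvd F"
  proof
    assume "int p dvd F"
    then have "int p dvd fact (p - 1)"
      unfolding F_def using p' prime_dvd_power by blast
    then have "int p dvd int (fact (p - 1))" by simp
    then have "p dvd fact (p - 1)"
      by (simp only: int_dvd_int_iff)
    then show False
      using p prime_dvd_fact_iff[OF p] prime_gt_0_nat[OF p] by simp
  qed
  ultimately show ?thesis
    using p' prime_dvd_mult_iff unfolding G_def by blast
qed

section \<open>Zero-sum index sets modulo \<open>n\<close>\<close>

text \<open>The coordinates are integers rather than residues, so that a sum divisible by
  \<open>d\<close> can be divided by \<open>d\<close> and read modulo the cofactor.\<close>

definition zero_sum_mod :: "nat \<Rightarrow> ('i \<Rightarrow> int) \<Rightarrow> ('i \<Rightarrow> int) \<Rightarrow> 'i set \<Rightarrow> bool" where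
  "zero_sum_mod n a b I \<longleftrightarrow> int n dvd sum a I \<and> int n dvd sum b I"

text \<open>Weight and the two coordinates are three linear conditions, hence the bound
  \<open>3 * (p - 1)\<close>.\<close>

lemma prime_dvd_alternating_weighted_count:
  assumes p: "prime p" and fin: "finite A" and card: "3 * (p - 1) < card A"
  shows "int p dvd (\<Sum>I | I \<subseteq> A \<and> int p dvd sum h I \<and> zero_sum_mod p a b I. (-1) ^ card I)"
proof -
  have "{I. I \<subseteq> A \<and> (\<forall>t\<in>{0, 1, 2::nat}. int p dvd sum (if t = 0 then h else if t = 1 then a else b) I)}
      = {I. I \<subseteq> A \<and> int p dvd sum h I \<and> zero_sum_mod p a b I}"
    by (auto simp: zero_sum_mod_def)
  then show ?thesis
    using prime_dvd_alternating_count[OF p _ fin, of "{0, 1, 2::nat}" "\<lambda>t. if t = 0 then h else if t = 1 then a else b"]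
      card by simp
qed

text \<open>
  The exceptional element \<open>c\<close> of weight 2 makes the property multiplicative in \<open>n\<close>: it stands for a
  block of weight \<open>2 * d\<close> instead of \<open>d\<close>, see \<open>weighted_egz_mult\<close>.
\<close>

definition weighted_egz :: "nat \<Rightarrow> bool" where
  "weighted_egz n \<longleftrightarrow> (\<forall>(A :: nat set) c (a :: nat \<Rightarrow> int) b (h :: nat \<Rightarrow> int).
    finite A \<and> card A = 3 * n - 3 \<and> c \<notin> A \<and> (\<forall>i\<in>A. h i = 1) \<and> (h c = 1 \<or> h c = 2) \<longrightarrow>
    (\<exists>I \<subseteq> insert c A. I \<noteq> {} \<and> int n dvd sum h I \<and> zero_sum_mod n a b I))"

text \<open>The indices are natural numbers so that numbered blocks can serve as indices in
  turn.\<close>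

definition kemnitz :: "nat \<Rightarrow> bool" where
  "kemnitz n \<longleftrightarrow> (\<forall>(A :: nat set) (a :: nat \<Rightarrow> int) b.
    finite A \<and> 4 * n - 3 \<le> card A \<longrightarrow> (\<exists>I \<subseteq> A. card I = n \<and> zero_sum_mod n a b I))"

lemma zero_sum_mod_Un:
  assumes "finite I" "finite J" "I \<inter> J = {}" "zero_sum_mod n a b I"
  shows "zero_sum_mod n a b (I \<union> J) \<longleftrightarrow> zero_sum_mod n a b J"
  using assms by (simp add: zero_sum_mod_def sum.union_disjoint dvd_add_right_iff)

lemma zero_sum_mod_Diff:
  assumes "finite J" "I \<subseteq> J" "zero_sum_mod n a b I" "zero_sum_mod n a b J"
  shows "zero_sum_mod n a b (J - I)"
  using assms by (simp add: zero_sum_mod_def sum_diff)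

text \<open>There are \<open>3 * p - 2\<close> indices, enough for the alternating count. Were the
  empty set the only solution, the count would be 1, which \<open>p\<close> does not divide.\<close>

lemma weighted_egz_prime:
  assumes p: "prime p"
  shows "weighted_egz p"
  unfolding weighted_egz_def
proof (intro allI impI)
  fix A :: "nat set" and c and a b h :: "nat \<Rightarrow> int"
  assume *: "finite A \<and> card A = 3 * p - 3 \<and> c \<notin> A \<and> (\<forall>i\<in>A. h i = 1) \<and> (h c = 1 \<or> h c = 2)"
  have p2: "p \<ge> 2" using p prime_ge_2_nat by blast
  let ?G = "{I. I \<subseteq> insert c A \<and> int p dvd sum h I \<and> zero_sum_mod p a b I}"
  show "\<exists>I \<subseteq> insert c A. I \<noteq> {} \<and> int p dvd sum h I \<and> zero_sum_mod p a b I"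
  proof (rule ccontr)
    assume "\<not> ?thesis"
    then have "?G = {{}}"
      by (auto simp: zero_sum_mod_def)
    moreover have "3 * (p - 1) < card (insert c A)"
      using * p2 by simp
    ultimately have "int p dvd 1"
      using prime_dvd_alternating_weighted_count[OF p, of "insert c A" h a b] * by simp
    then show False using p2 by simp
  qed
qed

text \<open>Any \<open>3 * n - 2\<close> of the indices contain a nonempty zero-sum set whose size
  is a multiple of \<open>n\<close> below \<open>3 * n\<close>. If the size is \<open>2 * n\<close>,
  the complement in \<open>A\<close> is zero-sum of size \<open>n\<close>.\<close>

lemma zero_sum_of_size_3n:
  fixes A :: "nat set"
  assumes n: "weighted_egz n" "n \<ge> 1" and A: "finite A" "card A = 3 * n" "zero_sum_mod n a b A"
  shows "\<exists>I \<subseteq> A. card I = n \<and> zero_sum_mod n a b I"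
proof -
  obtain B where B: "B \<subseteq> A" "card B = 3 * n - 3" "finite B"
    using obtain_subset_with_card_n[of "3 * n - 3" A] A by auto
  then have "B \<noteq> A" using A n(2) by auto
  then obtain c where c: "c \<in> A" "c \<notin> B" using B by blast
  obtain I where I: "I \<subseteq> insert c B" "I \<noteq> {}" "int n dvd (\<Sum>i\<in>I. 1)" "zero_sum_mod n a b I"
    using n(1)[unfolded weighted_egz_def, rule_format, of B c "\<lambda>_. 1" a b] B c by auto
  have IA: "I \<subseteq> A" "finite I" using I(1) B c A(1) finite_subset by auto
  have "card I \<le> card (insert c B)"
    using I(1) B by (intro card_mono) auto
  then have le: "card I < 3 * n" using B c n(2) by simp
  have "n dvd card I" using I(3) by simp
  then obtain q where q: "card I = n * q" by blast
  have "q > 0" using q I(2) IA(2) by (cases q) auto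
  moreover have "q < 3" using le n(2) unfolding q by (simp add: mult.commute)
  ultimately consider "q = 1" | "q = 2" by linarith
  then show ?thesis
  proof cases
    case 1
    then show ?thesis using I IA q by auto
  next
    case 2
    have "card (A - I) = n"
      using IA A q 2 by (simp add: card_Diff_subset)
    then show ?thesis
      using zero_sum_mod_Diff[OF A(1) IA(1) I(4) A(3)] by blast
  qed
qed

section \<open>Counting zero-sum sets of a given size\<close>

definition zero_sum_count :: "nat \<Rightarrow> ('i \<Rightarrow> int) \<Rightarrow> ('i \<Rightarrow> int) \<Rightarrow> 'i set \<Rightarrow> nat \<Rightarrow> nat" where
  "zero_sum_count n a b A k = card {I. I \<subseteq> A \<and> card I = k \<and> zero_sum_mod n a b I}"

lemma zero_sum_count_eq_0:
  assumes "finite A" "card A < k"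
  shows "zero_sum_count n a b A k = 0"
proof -
  have "{I. I \<subseteq> A \<and> card I = k \<and> zero_sum_mod n a b I} = {}"
    using assms by (auto dest: card_mono)
  then show ?thesis by (simp only: zero_sum_count_def card.empty)
qed

lemma zero_sum_count_0:
  assumes "finite A"
  shows "zero_sum_count n a b A 0 = 1"
proof -
  have "{I. I \<subseteq> A \<and> card I = 0 \<and> zero_sum_mod n a b I} = {{}}"
    using assms finite_subset by (fastforce simp: zero_sum_mod_def)
  then show ?thesis by (simp add: zero_sum_count_def)
qed

text \<open>A Pascal-type recursion: a set either avoids \<open>x\<close> or contains it, and
  \<open>x\<close> contributes nothing to the sums.\<close>

lemma zero_sum_count_insert_zero:
  assumes A: "finite A" "x \<notin> A"
  shows "zero_sum_count n (a(x := 0)) (b(x := 0)) (insert x A) (Suc k)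
    = zero_sum_count n a b A (Suc k) + zero_sum_count n a b A k"
proof -
  let ?S = "\<lambda>k. {I. I \<subseteq> A \<and> card I = k \<and> zero_sum_mod n a b I}"
  have same: "zero_sum_mod n (a(x := 0)) (b(x := 0)) I = zero_sum_mod n a b I"
    "zero_sum_mod n (a(x := 0)) (b(x := 0)) (insert x I) = zero_sum_mod n a b I" if "I \<subseteq> A" for I
  proof -
    have "x \<notin> I" "finite I" using that A finite_subset by auto
    moreover from this have "sum (f(x := 0)) I = sum f I" for f :: "'a \<Rightarrow> int"
      by (intro sum.cong) auto
    ultimately show "zero_sum_mod n (a(x := 0)) (b(x := 0)) I = zero_sum_mod n a b I"
      "zero_sum_mod n (a(x := 0)) (b(x := 0)) (insert x I) = zero_sum_mod n a b I"
      by (simp_all add: zero_sum_mod_def)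
  qed
  have "{I. I \<subseteq> insert x A \<and> card I = Suc k \<and> zero_sum_mod n (a(x := 0)) (b(x := 0)) I}
      = ?S (Suc k) \<union> insert x ` ?S k" (is "?L = ?R")
  proof (intro equalityI subsetI)
    fix I assume I: "I \<in> ?L"
    show "I \<in> ?R"
    proof (cases "x \<in> I")
      case True
      define J where "J = I - {x}"
      have J: "I = insert x J" "x \<notin> J" "J \<subseteq> A" "finite J"
        using I True A by (auto simp: J_def intro: finite_subset)
      then have "J \<in> ?S k" using I same(2)[of J] by auto
      then show ?thesis using J(1) by blast
    next
      case False
      then show ?thesis using I same(1)[of I] by auto
    qed
  next
    fix I assume "I \<in> ?R"
    then show "I \<in> ?L"
    proof
      assume "I \<in> ?S (Suc k)"
      then show ?thesis using same(1)[of I] by auto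
    next
      assume "I \<in> insert x ` ?S k"
      then obtain J where J: "J \<in> ?S k" "I = insert x J" by blast
      then have "x \<notin> J" "finite J" using A finite_subset by auto
      then show ?thesis using J same(2)[of J] by auto
    qed
  qed
  moreover have "?S (Suc k) \<inter> insert x ` ?S k = {}" using A by auto
  moreover have "inj_on (insert x) (?S k)" using A by (auto simp: inj_on_def)
  moreover have "finite (?S k)" "finite (?S (Suc k))" using A by auto
  ultimately show ?thesis
    by (simp add: zero_sum_count_def card_Un_disjoint card_image)
qed

text \<open>Double counting: a zero-sum set of size \<open>k\<close> is extended to a set of size
  \<open>m\<close> by choosing \<open>m - k\<close> of the remaining \<open>card X - k\<close>
  elements.\<close>

lemma sum_zero_sum_count_subsets:
  assumes X: "finite X" and km: "k \<le> m"
  shows "(\<Sum>J | J \<subseteq> X \<and> card J = m. zero_sum_count n a b J k)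
    = ((card X - k) choose (m - k)) * zero_sum_count n a b X k"
proof -
  let ?Z = "{I. I \<subseteq> X \<and> card I = k \<and> zero_sum_mod n a b I}"
  let ?M = "{J. J \<subseteq> X \<and> card J = m}"
  have fin: "finite ?Z" "finite ?M" using X by auto
  have "(\<Sum>J\<in>?M. zero_sum_count n a b J k) = (\<Sum>J\<in>?M. \<Sum>I\<in>?Z. if I \<subseteq> J then 1 else 0)"
  proof (rule sum.cong)
    fix J assume "J \<in> ?M"
    then have "{I. I \<subseteq> J \<and> card I = k \<and> zero_sum_mod n a b I} = ?Z \<inter> {I. I \<subseteq> J}" by auto
    then show "zero_sum_count n a b J k = (\<Sum>I\<in>?Z. if I \<subseteq> J then 1 else 0)"
      using fin by (simp add: zero_sum_count_def sum.If_cases)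
  qed simp
  also have "\<dots> = (\<Sum>I\<in>?Z. \<Sum>J\<in>?M. if I \<subseteq> J then 1 else 0)"
    by (rule sum.swap)
  also have "\<dots> = (\<Sum>I\<in>?Z. (card X - k) choose (m - k))"
  proof (rule sum.cong)
    fix I assume I: "I \<in> ?Z"
    then have finI: "finite I" using X finite_subset by auto
    have "bij_betw (\<lambda>J. J - I) (?M \<inter> {J. I \<subseteq> J}) {J. J \<subseteq> X - I \<and> card J = m - k}"
    proof (rule bij_betw_byWitness[where f' = "\<lambda>J. J \<union> I"])
      show "(\<lambda>J. J - I) ` (?M \<inter> {J. I \<subseteq> J}) \<subseteq> {J. J \<subseteq> X - I \<and> card J = m - k}"
        using I finI by (auto simp: card_Diff_subset)
      show "(\<lambda>J. J \<union> I) ` {J. J \<subseteq> X - I \<and> card J = m - k} \<subseteq> ?M \<inter> {J. I \<subseteq> J}"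
      proof
        fix K assume "K \<in> (\<lambda>J. J \<union> I) ` {J. J \<subseteq> X - I \<and> card J = m - k}"
        then obtain J where J: "K = J \<union> I" "J \<subseteq> X - I" "card J = m - k" by blast
        then have "finite J" using X finite_subset by blast
        then have "card K = m"
          using J finI I km by (subst J(1), subst card_Un_disjoint) auto
        then show "K \<in> ?M \<inter> {J. I \<subseteq> J}" using J I by auto
      qed
    qed auto
    then have "card (?M \<inter> {J. I \<subseteq> J}) = card {J. J \<subseteq> X - I \<and> card J = m - k}"
      by (rule bij_betw_same_card)
    also have "\<dots> = (card X - k) choose (m - k)"
      using I X finI by (simp add: n_subsets card_Diff_subset)
    finally show "(\<Sum>J\<in>?M. if I \<subseteq> J then 1 else 0) = (card X - k) choose (m - k)"
      using fin by (simp add: sum.If_cases)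
  qed simp
  also have "\<dots> = ((card X - k) choose (m - k)) * zero_sum_count n a b X k"
    by (simp add: zero_sum_count_def)
  finally show ?thesis .
qed

text \<open>With all weights 1 the alternating count only sees sizes divisible by \<open>p\<close>,
  here 0, \<open>p\<close>, \<open>2 * p\<close> and \<open>3 * p\<close>; since \<open>p\<close> is
  odd, their signs alternate.\<close>

lemma prime_dvd_alternating_zero_sum_count:
  assumes p: "prime p" "odd p" and A: "finite A" "3 * (p - 1) < card A" "card A < 4 * p"
  shows "int p dvd 1 - int (zero_sum_count p a b A p) + int (zero_sum_count p a b A (2 * p))
    - int (zero_sum_count p a b A (3 * p))"
proof -
  define S where "S = {I. I \<subseteq> A \<and> int p dvd (\<Sum>i\<in>I. 1) \<and> zero_sum_mod p a b I}"
  have p0: "p > 0" using p(1) prime_gt_0_nat by blast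
  have finS: "finite S" using A(1) by (simp add: S_def)
  have "card I div p \<in> {..<4}" if "I \<in> S" for I
  proof -
    have "card I \<le> card A" using that A(1) by (auto simp: S_def intro: card_mono)
    then have "card I < 4 * p" using A(3) by simp
    then show ?thesis using p0 by (simp add: div_less_iff_less_mult mult.commute)
  qed
  then have "(\<Sum>I\<in>S. (-1::int) ^ card I) = (\<Sum>q<4. \<Sum>I | I \<in> S \<and> card I div p = q. (-1) ^ card I)"
    using finS by (intro sum.group[symmetric]) auto
  also have "\<dots> = (\<Sum>q<4. (-1) ^ q * int (zero_sum_count p a b A (q * p)))"
  proof (rule sum.cong)
    fix q
    have "{I \<in> S. card I div p = q} = {I. I \<subseteq> A \<and> card I = q * p \<and> zero_sum_mod p a b I}"
      using p0 by (auto simp: S_def)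
    moreover have "(-1::int) ^ (q * p) = (-1) ^ q"
      using p(2) by (simp add: minus_one_power_iff)
    ultimately show "(\<Sum>I | I \<in> S \<and> card I div p = q. (-1) ^ card I)
        = (-1) ^ q * int (zero_sum_count p a b A (q * p))"
      by (simp add: zero_sum_count_def)
  qed simp
  also have "\<dots> = 1 - int (zero_sum_count p a b A p) + int (zero_sum_count p a b A (2 * p))
      - int (zero_sum_count p a b A (3 * p))"
  proof -
    have "{..<4::nat} = {0, 1, 2, 3}" by auto
    then show ?thesis using A(1) by (simp add: zero_sum_count_0)
  qed
  finally show ?thesis
    using prime_dvd_alternating_weighted_count[OF p(1) A(1,2), of "\<lambda>_. 1" a b]
    unfolding S_def by simp
qed

text \<open>
  Adding an index with value \<open>(0, 0)\<close> lowers the required cardinality by one.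
\<close>

lemma prime_dvd_alternating_zero_sum_count':
  fixes A :: "nat set"
  assumes p: "prime p" "odd p" and A: "finite A" "3 * p - 3 \<le> card A" "card A + 1 < 4 * p"
  shows "int p dvd 1
    - (int (zero_sum_count p a b A p) + int (zero_sum_count p a b A (p - 1)))
    + (int (zero_sum_count p a b A (2 * p)) + int (zero_sum_count p a b A (2 * p - 1)))
    - (int (zero_sum_count p a b A (3 * p)) + int (zero_sum_count p a b A (3 * p - 1)))"
proof -
  obtain x where x: "x \<notin> A" using A(1) ex_new_if_finite infinite_UNIV_nat by blast
  have p0: "p > 0" using p(1) prime_gt_0_nat by blast
  have *: "zero_sum_count p (a(x := 0)) (b(x := 0)) (insert x A) k
      = zero_sum_count p a b A k + zero_sum_count p a b A (k - 1)" if "k > 0" for k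
    using zero_sum_count_insert_zero[OF A(1) x, of p a b "k - 1"] that by simp
  show ?thesis
    using prime_dvd_alternating_zero_sum_count[OF p, of "insert x A" "a(x := 0)" "b(x := 0)"]
      A x p0 by (simp add: *)
qed

section \<open>Binomial coefficients modulo a prime\<close>

text \<open>In Vandermonde's convolution \<open>p choose k\<close> is divisible by \<open>p\<close>
  except for \<open>k = 0\<close> and \<open>k = p\<close>.\<close>

lemma prime_choose_add_cong:
  fixes p s :: nat
  assumes p: "prime p"
  shows "[(p + s) choose p = (s choose p) + 1] (mod p)"
proof -
  have p0: "p > 0" using p prime_gt_0_nat by blast
  have "(p + s) choose p = (\<Sum>k\<le>p. (p choose k) * (s choose (p - k)))"
    by (rule vandermonde[symmetric])
  also have "[\<dots> = (\<Sum>k\<le>p. if k = 0 then s choose p else if k = p then 1 else 0)] (mod p)"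
  proof (rule cong_sum)
    fix k assume "k \<in> {..p}"
    then have "p dvd (p choose k)" if "k \<noteq> 0" "k \<noteq> p"
      using that p p0 by (intro dvd_choose_prime) auto
    then show "[(p choose k) * (s choose (p - k)) = (if k = 0 then s choose p else if k = p then 1 else 0)] (mod p)"
      by (auto simp: cong_0_iff)
  qed
  also have "(\<Sum>k\<le>p. if k = 0 then s choose p else if k = p then 1 else 0) = (s choose p) + 1"
  proof -
    have "(\<Sum>k\<le>p. if k = 0 then s choose p else if k = p then 1 else 0)
        = (\<Sum>k\<le>p. (if k = 0 then s choose p else 0) + (if k = p then 1 else 0))"
      using p0 by (intro sum.cong) auto
    then show ?thesis by (simp add: sum.distrib)
  qed
  finally show ?thesis .
qed

text \<open>A special case of Lucas' theorem: raising the upper index by \<open>p\<close> adds 1,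
  starting from 0 at \<open>r < p\<close>.\<close>

lemma prime_choose_cong:
  assumes p: "prime p" and r: "r < p"
  shows "[(q * p + r) choose p = q] (mod p)"
proof (induction q)
  case 0
  then show ?case using r by (simp add: binomial_eq_0)
next
  case (Suc q)
  have "[(p + (q * p + r)) choose p = ((q * p + r) choose p) + 1] (mod p)"
    by (rule prime_choose_add_cong[OF p])
  also have "[((q * p + r) choose p) + 1 = q + 1] (mod p)"
    using Suc.IH cong_add_rcancel_nat by blast
  finally show ?case by (simp add: add.assoc)
qed

section \<open>The Kemnitz conjecture for primes\<close>

text \<open>
  Both sides count the pairs of disjoint zero-sum sets of sizes \<open>p - 1\<close> and \<open>2 * p\<close>, the right-hand
  side by their union.
\<close>

lemma zero_sum_count_pairs:
  assumes X: "finite X"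
  shows "(\<Sum>A | A \<subseteq> X \<and> card A = k \<and> zero_sum_mod n a b A. zero_sum_count n a b (X - A) m)
    = (\<Sum>D | D \<subseteq> X \<and> card D = k + m \<and> zero_sum_mod n a b D. zero_sum_count n a b D m)"
proof -
  let ?Z = "\<lambda>Y k. {I. I \<subseteq> Y \<and> card I = k \<and> zero_sum_mod n a b I}"
  have "(\<Sum>A\<in>?Z X k. zero_sum_count n a b (X - A) m) = card (SIGMA A:?Z X k. ?Z (X - A) m)"
    using X by (subst card_SigmaI) (auto simp: zero_sum_count_def)
  also have "\<dots> = card (SIGMA D:?Z X (k + m). ?Z D m)"
  proof (rule bij_betw_same_card, rule bij_betw_byWitness[where f = "\<lambda>(A, C). (A \<union> C, C)" and f' = "\<lambda>(D, C). (D - C, C)"])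
    show "(\<lambda>(A, C). (A \<union> C, C)) ` (SIGMA A:?Z X k. ?Z (X - A) m) \<subseteq> (SIGMA D:?Z X (k + m). ?Z D m)"
    proof (rule image_subsetI)
      fix z assume "z \<in> (SIGMA A:?Z X k. ?Z (X - A) m)"
      then obtain A C where z: "z = (A, C)"
        and AC: "A \<subseteq> X" "card A = k" "zero_sum_mod n a b A" "C \<subseteq> X - A" "card C = m" "zero_sum_mod n a b C"
        by blast
      have fin: "finite A" "finite C" and disj: "A \<inter> C = {}"
        using X AC by (auto intro: finite_subset[of A X] finite_subset[of C "X - A"])
      then have "zero_sum_mod n a b (A \<union> C)" "card (A \<union> C) = k + m"
        using AC by (simp_all add: zero_sum_mod_Un card_Un_disjoint)
      then show "(case z of (A, C) \<Rightarrow> (A \<union> C, C)) \<in> (SIGMA D:?Z X (k + m). ?Z D m)"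
        using AC z by auto
    qed
    show "(\<lambda>(D, C). (D - C, C)) ` (SIGMA D:?Z X (k + m). ?Z D m) \<subseteq> (SIGMA A:?Z X k. ?Z (X - A) m)"
    proof (rule image_subsetI)
      fix z assume "z \<in> (SIGMA D:?Z X (k + m). ?Z D m)"
      then obtain D C where z: "z = (D, C)"
        and DC: "D \<subseteq> X" "card D = k + m" "zero_sum_mod n a b D" "C \<subseteq> D" "card C = m" "zero_sum_mod n a b C"
        by blast
      have fin: "finite D" "finite C"
        using X DC finite_subset by metis+
      then have "zero_sum_mod n a b (D - C)" "card (D - C) = k"
        using DC by (simp_all add: zero_sum_mod_Diff card_Diff_subset)
      then show "(case z of (D, C) \<Rightarrow> (D - C, C)) \<in> (SIGMA A:?Z X k. ?Z (X - A) m)"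
        using DC z by auto
    qed
  qed auto
  also have "\<dots> = (\<Sum>D\<in>?Z X (k + m). zero_sum_count n a b D m)"
  proof (subst card_SigmaI)
    show "\<forall>D\<in>?Z X (k + m). finite (?Z D m)"
      using X finite_subset[OF _ X] by auto
  qed (use X in \<open>simp_all add: zero_sum_count_def\<close>)
  finally show ?thesis .
qed

lemma zero_sum_count_mono_eq_0:
  assumes "finite X" "Y \<subseteq> X" "zero_sum_count n a b X k = 0"
  shows "zero_sum_count n a b Y k = 0"
proof -
  have "zero_sum_count n a b Y k \<le> zero_sum_count n a b X k"
    unfolding zero_sum_count_def using assms by (intro card_mono) auto
  then show ?thesis using assms(3) by simp
qed

text \<open>By \<open>zero_sum_of_size_3n\<close>, a zero-sum set of size \<open>3 * p\<close> would
  contain one of size \<open>p\<close>.\<close>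

lemma zero_sum_count_3p_eq_0:
  fixes A :: "nat set"
  assumes p: "prime p" and A: "finite A" "zero_sum_count p a b A p = 0"
  shows "zero_sum_count p a b A (3 * p) = 0"
proof -
  have none: "{I. I \<subseteq> A \<and> card I = p \<and> zero_sum_mod p a b I} = {}"
    using A by (simp add: zero_sum_count_def)
  have "\<not> (J \<subseteq> A \<and> card J = 3 * p \<and> zero_sum_mod p a b J)" for J
  proof
    assume J: "J \<subseteq> A \<and> card J = 3 * p \<and> zero_sum_mod p a b J"
    then have "finite J" using A(1) finite_subset by blast
    then obtain I where "I \<subseteq> J" "card I = p" "zero_sum_mod p a b I"
      using zero_sum_of_size_3n[OF weighted_egz_prime[OF p], of J a b] J prime_gt_0_nat[OF p] by auto
    then show False using none J by blast
  qed
  then have "{I. I \<subseteq> A \<and> card I = 3 * p \<and> zero_sum_mod p a b I} = {}" by blast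
  then show ?thesis by (simp only: zero_sum_count_def card.empty)
qed

text \<open>Two of five indices agree in both coordinates modulo 2 and so add up to zero. The prime
  2 is treated apart because the congruences for \<open>zero_sum_count\<close> assume
  \<open>p\<close> odd.\<close>

lemma kemnitz_2: "kemnitz 2"
  unfolding kemnitz_def
proof (intro allI impI)
  fix A :: "nat set" and a b :: "nat \<Rightarrow> int"
  assume A: "finite A \<and> 4 * 2 - 3 \<le> card A"
  let ?f = "\<lambda>i. (a i mod 2, b i mod 2)"
  have "?f ` A \<subseteq> {0, 1} \<times> {0, 1}"
    by auto
  then have "card (?f ` A) \<le> card ({0, 1::int} \<times> {0, 1::int})"
    by (intro card_mono) auto
  then have "\<not> inj_on ?f A"
    using A by (intro pigeonhole) auto
  then obtain i j where ij: "i \<in> A" "j \<in> A" "i \<noteq> j" "a i mod 2 = a j mod 2" "b i mod 2 = b j mod 2"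
    by (auto simp: inj_on_def)
  then have "zero_sum_mod 2 a b {i, j}"
    by (simp add: zero_sum_mod_def) presburger
  then show "\<exists>I \<subseteq> A. card I = 2 \<and> zero_sum_mod 2 a b I"
    using ij by (intro exI[of _ "{i, j}"]) auto
qed

text \<open>
  Reiher's argument: the congruence for the whole of \<open>X\<close>, those for the subsets of size \<open>3 * p - 3\<close>
  averaged, and a double count of pairs of disjoint zero-sum sets combine to \<open>p dvd 2\<close>.
\<close>

lemma exists_zero_sum_of_prime_size:
  fixes X :: "nat set"
  assumes p: "prime p" "odd p" and X: "finite X" "card X = 4 * p - 3"
  shows "zero_sum_count p a b X p \<noteq> 0"
proof
  assume none: "zero_sum_count p a b X p = 0"
  have p3: "p \<ge> 3" using p prime_ge_2_nat[of p] by (cases "p = 2") auto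
  let ?N = "\<lambda>J k. int (zero_sum_count p a b J k)"
  have sub: "zero_sum_count p a b Y p = 0" "zero_sum_count p a b Y (3 * p) = 0" "finite Y" if "Y \<subseteq> X" for Y
    using that zero_sum_count_mono_eq_0[OF X(1) that none] finite_subset[OF that X(1)]
      zero_sum_count_3p_eq_0[OF p(1), of Y a b] by auto
  \<comment> \<open>Without zero-sum sets of size \<open>p\<close> or \<open>3 * p\<close>, the
    congruence retains only the sizes 0 and \<open>2 * p\<close>.\<close>
  have N2p: "int p dvd 1 + ?N Y (2 * p)" if "Y \<subseteq> X" "3 * p - 2 \<le> card Y" for Y
  proof -
    have "card Y < 4 * p" using card_mono[OF X(1) that(1)] X(2) p3 by linarith
    then show ?thesis
      using prime_dvd_alternating_zero_sum_count[OF p, of Y a b] sub[OF that(1)] that(2) p3 by simp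
  qed
  have E1: "int p dvd 1 + ?N X (2 * p)"
    using X(2) by (intro N2p) auto
  have "int p dvd 1 - (0 + ?N X (p - 1)) + (?N X (2 * p) + ?N X (2 * p - 1)) - (0 + ?N X (3 * p - 1))"
    using prime_dvd_alternating_zero_sum_count'[OF p X(1), of a b] X(2) sub[of X] p3 by simp
  \<comment> \<open>Subtracting \<open>E1\<close> removes the constant 1 and the count for
    \<open>2 * p\<close>.\<close>
  then have E2: "int p dvd - ?N X (p - 1) + ?N X (2 * p - 1) - ?N X (3 * p - 1)"
    using dvd_diff[OF _ E1] by (force simp: algebra_simps)
  have E3: "int p dvd 3 - 2 * ?N X (p - 1) + ?N X (2 * p - 1) + ?N X (2 * p)"
  proof -
    \<comment> \<open>The congruence is summed over all subsets of size \<open>3 * p - 3\<close>,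
      which are too small to contain a set of size \<open>3 * p - 1\<close>. A zero-sum set of size
      \<open>k\<close> lies in \<open>(4 * p - 3 - k) choose p\<close> of them.\<close>
    let ?M = "{J. J \<subseteq> X \<and> card J = 3 * p - 3}"
    have binom: "[int ((q * p + r) choose p) = int q] (mod int p)" if "r < p" for q r
      using prime_choose_cong[OF p(1) that, of q] by (simp add: cong_int_iff)
    have count: "(\<Sum>J\<in>?M. ?N J k) = int ((4 * p - 3 - k) choose p) * ?N X k" if "k \<le> 3 * p - 3" for k
    proof -
      have "(4 * p - 3 - k) choose (3 * p - 3 - k) = (4 * p - 3 - k) choose p"
        using that p3 by (subst binomial_symmetric) auto
      then show ?thesis
        using sum_zero_sum_count_subsets[OF X(1) that, of p a b] X(2)
        by (simp flip: of_nat_sum of_nat_mult)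
    qed
    have "int p dvd (\<Sum>J\<in>?M. 1 - ?N J (p - 1) + ?N J (2 * p - 1) + ?N J (2 * p))"
    proof (rule dvd_sum)
      fix J assume J: "J \<in> ?M"
      then have fin: "finite J" using sub by blast
      have "?N J (3 * p - 1) = 0"
        using J p3 by (simp add: zero_sum_count_eq_0[OF fin])
      then show "int p dvd 1 - ?N J (p - 1) + ?N J (2 * p - 1) + ?N J (2 * p)"
        using prime_dvd_alternating_zero_sum_count'[OF p fin, of a b] J sub[of J] p3
        by (simp add: add_ac)
    qed
    also have "(\<Sum>J\<in>?M. 1 - ?N J (p - 1) + ?N J (2 * p - 1) + ?N J (2 * p))
        = int (card ?M) - (\<Sum>J\<in>?M. ?N J (p - 1)) + (\<Sum>J\<in>?M. ?N J (2 * p - 1)) + (\<Sum>J\<in>?M. ?N J (2 * p))"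
      by (simp add: sum.distrib sum_subtractf)
    also have "card ?M = (4 * p - 3) choose p"
      using X p3 by (simp add: n_subsets) (subst binomial_symmetric, auto)
    also have "int ((4 * p - 3) choose p) - (\<Sum>J\<in>?M. ?N J (p - 1)) + (\<Sum>J\<in>?M. ?N J (2 * p - 1))
          + (\<Sum>J\<in>?M. ?N J (2 * p))
        = int ((3 * p + (p - 3)) choose p) - int ((2 * p + (p - 2)) choose p) * ?N X (p - 1)
          + int ((1 * p + (p - 2)) choose p) * ?N X (2 * p - 1)
          + int ((1 * p + (p - 3)) choose p) * ?N X (2 * p)"
    proof -
      \<comment> \<open>Written as \<open>q * p + r\<close> with \<open>r < p\<close>, the upper
        indices have quotients 3, 2, 1, 1, which become the coefficients modulo
        \<open>p\<close>.\<close>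
      have eq: "4 * p - 3 = 3 * p + (p - 3)" "4 * p - 3 - (p - 1) = 2 * p + (p - 2)"
        "4 * p - 3 - (2 * p - 1) = 1 * p + (p - 2)" "4 * p - 3 - 2 * p = 1 * p + (p - 3)"
        and le: "p - 1 \<le> 3 * p - 3" "2 * p - 1 \<le> 3 * p - 3" "2 * p \<le> 3 * p - 3"
        using p3 by linarith+
      show ?thesis
        by (simp only: count[OF le(1), unfolded eq(2)] count[OF le(2), unfolded eq(3)]
          count[OF le(3), unfolded eq(4)]) (simp only: eq(1))
    qed
    finally have "[int ((3 * p + (p - 3)) choose p) - int ((2 * p + (p - 2)) choose p) * ?N X (p - 1)
          + int ((1 * p + (p - 2)) choose p) * ?N X (2 * p - 1)
          + int ((1 * p + (p - 3)) choose p) * ?N X (2 * p) = 0] (mod int p)"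
      by (simp only: cong_0_iff)
    moreover have "[int ((3 * p + (p - 3)) choose p) - int ((2 * p + (p - 2)) choose p) * ?N X (p - 1)
          + int ((1 * p + (p - 2)) choose p) * ?N X (2 * p - 1)
          + int ((1 * p + (p - 3)) choose p) * ?N X (2 * p)
        = int 3 - int 2 * ?N X (p - 1) + int 1 * ?N X (2 * p - 1) + int 1 * ?N X (2 * p)] (mod int p)"
      using p3 by (intro cong_add cong_diff cong_mult binom cong_refl) auto
    ultimately have "[int 3 - int 2 * ?N X (p - 1) + int 1 * ?N X (2 * p - 1) + int 1 * ?N X (2 * p) = 0] (mod int p)"
      using cong_trans cong_sym by blast
    then show ?thesis by (simp add: cong_0_iff)
  qed
  have E4: "int p dvd ?N X (p - 1) - ?N X (3 * p - 1)"
  proof -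
    let ?A = "{A. A \<subseteq> X \<and> card A = p - 1 \<and> zero_sum_mod p a b A}"
    let ?D = "{D. D \<subseteq> X \<and> card D = 3 * p - 1 \<and> zero_sum_mod p a b D}"
    have pairs: "(\<Sum>A\<in>?A. ?N (X - A) (2 * p)) = (\<Sum>D\<in>?D. ?N D (2 * p))"
    proof -
      have "p - 1 + 2 * p = 3 * p - 1" using p3 by simp
      then show ?thesis
        using zero_sum_count_pairs[OF X(1), of p a b "2 * p" "p - 1"]
        by (simp flip: of_nat_sum)
    qed
    \<comment> \<open>Each summand vanishes modulo \<open>p\<close> by \<open>N2p\<close>, since
      \<open>X - A\<close> has \<open>3 * p - 2\<close> elements and \<open>D\<close> has
      \<open>3 * p - 1\<close>. As the double sums agree, the numbers of sets \<open>A\<close> and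
      \<open>D\<close> are congruent.\<close>
    have "int p dvd (\<Sum>A\<in>?A. 1 + ?N (X - A) (2 * p))"
    proof (rule dvd_sum)
      fix A assume A: "A \<in> ?A"
      then have "card (X - A) = 3 * p - 2"
        using X p3 sub(3) by (auto simp: card_Diff_subset)
      then show "int p dvd 1 + ?N (X - A) (2 * p)" by (intro N2p) auto
    qed
    moreover have "int p dvd (\<Sum>D\<in>?D. 1 + ?N D (2 * p))"
      by (rule dvd_sum, rule N2p) auto
    ultimately have "int p dvd (\<Sum>A\<in>?A. 1 + ?N (X - A) (2 * p)) - (\<Sum>D\<in>?D. 1 + ?N D (2 * p))"
      by (rule dvd_diff)
    then show ?thesis
      unfolding sum.distrib pairs by (simp add: zero_sum_count_def)
  qed
  obtain k1 k2 k3 k4 where k: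
    "1 + ?N X (2 * p) = int p * k1"
    "- ?N X (p - 1) + ?N X (2 * p - 1) - ?N X (3 * p - 1) = int p * k2"
    "3 - 2 * ?N X (p - 1) + ?N X (2 * p - 1) + ?N X (2 * p) = int p * k3"
    "?N X (p - 1) - ?N X (3 * p - 1) = int p * k4"
    using E1 E2 E3 E4 by (auto elim!: dvdE)
  \<comment> \<open>In \<open>E3 - E2 - E1 + E4\<close> all counts cancel.\<close>
  then have "2 = int p * (k3 - k2 - k1 + k4)"
    unfolding right_diff_distrib distrib_left by linarith
  then have "int p dvd 2" by (rule dvdI)
  then have "p \<le> 2" using zdvd_imp_le[of "int p" 2] by simp
  then show False using p3 by simp
qed

lemma kemnitz_prime:
  assumes p: "prime p"
  shows "kemnitz p"
proof (cases "p = 2")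
  case False
  then have "odd p" using p primes_dvd_imp_eq two_is_prime_nat by blast
  show ?thesis
    unfolding kemnitz_def
  proof (intro allI impI)
    fix A :: "nat set" and a b :: "nat \<Rightarrow> int"
    assume "finite A \<and> 4 * p - 3 \<le> card A"
    then obtain X where X: "X \<subseteq> A" "card X = 4 * p - 3" "finite X"
      using obtain_subset_with_card_n by blast
    have "{I. I \<subseteq> X \<and> card I = p \<and> zero_sum_mod p a b I} \<noteq> {}"
      using exists_zero_sum_of_prime_size[OF p \<open>odd p\<close> X(3,2), of a b]
      unfolding zero_sum_count_def by force
    then show "\<exists>I \<subseteq> A. card I = p \<and> zero_sum_mod p a b I"
      using X(1) by blast
  qed
qed (simp add: kemnitz_2)

section \<open>Zero-sum blocks and multiplicativity in the modulus\<close>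

lemma disjoint_family_on_fun_upd_Suc:
  fixes k :: nat
  assumes disj: "disjoint_family_on B {..<k}" and J: "J \<inter> (\<Union>i<k. B i) = {}"
  shows "disjoint_family_on (B(k := J)) {..<Suc k}"
proof -
  have "disjoint_family_on (B(k := J)) {..<k} = disjoint_family_on B {..<k}"
    by (auto simp: disjoint_family_on_def)
  moreover have "(\<Union>i<k. (B(k := J)) i) = (\<Union>i<k. B i)" by auto
  ultimately show ?thesis
    using disj J by (simp only: lessThan_Suc disjoint_family_on_insert[of k "{..<k}"] lessThan_iff less_irrefl not_False_eq_True fun_upd_same)
qed

lemma kemnitz_blocks:
  fixes A :: "nat set"
  assumes K: "kemnitz d" and A: "finite A" "k * d + 3 * d - 3 \<le> card A"
  shows "\<exists>B. (\<forall>i<k. B i \<subseteq> A \<and> card (B i) = d \<and> zero_sum_mod d a b (B i)) \<and> disjoint_family_on B {..<k}"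
  using A(2)
proof (induction k)
  case 0
  then show ?case by (simp add: disjoint_family_on_def)
next
  case (Suc k)
  then have "k * d + 3 * d - 3 \<le> card A" by simp
  then obtain B where B: "\<And>i. i < k \<Longrightarrow> B i \<subseteq> A \<and> card (B i) = d \<and> zero_sum_mod d a b (B i)"
    and disj: "disjoint_family_on B {..<k}"
    using Suc.IH by blast
  define U where "U = (\<Union>i<k. B i)"
  have U: "U \<subseteq> A" "finite U" using B A(1) finite_subset[of U A] by (auto simp: U_def)
  have "card U = (\<Sum>i<k. card (B i))"
    unfolding U_def using B disj A(1)
    by (intro card_UN_disjoint) (auto simp: disjoint_family_on_def intro: finite_subset)
  then have "card U = k * d" using B by simp
  then have "4 * d - 3 \<le> card (A - U)"
    using U Suc.prems by (simp add: card_Diff_subset)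
  then obtain I where I: "I \<subseteq> A - U" "card I = d" "zero_sum_mod d a b I"
    using K A(1) unfolding kemnitz_def by (metis finite_Diff)
  have "disjoint_family_on (B(k := I)) {..<Suc k}"
    using disj I(1) by (intro disjoint_family_on_fun_upd_Suc) (auto simp: U_def)
  moreover have "\<forall>i<Suc k. (B(k := I)) i \<subseteq> A \<and> card ((B(k := I)) i) = d \<and> zero_sum_mod d a b ((B(k := I)) i)"
    using B I by (auto simp: less_Suc_eq)
  ultimately show ?case by blast
qed

text \<open>The sum over the union is \<open>d\<close> times the sum of the divided block sums, and
  the latter is divisible by \<open>m\<close>.\<close>

lemma zero_sum_mod_UN_blocks:
  assumes fin: "finite I" "\<And>i. i \<in> I \<Longrightarrow> finite (B i)" and disj: "disjoint_family_on B I"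
    and B: "\<And>i. i \<in> I \<Longrightarrow> zero_sum_mod d a b (B i)"
    and I: "zero_sum_mod m (\<lambda>i. sum a (B i) div int d) (\<lambda>i. sum b (B i) div int d) I"
  shows "zero_sum_mod (d * m) a b (\<Union>i\<in>I. B i)"
proof -
  have "int (d * m) dvd sum f (\<Union>i\<in>I. B i)"
    if "\<And>i. i \<in> I \<Longrightarrow> int d dvd sum f (B i)" "int m dvd (\<Sum>i\<in>I. sum f (B i) div int d)" for f
  proof -
    have "sum f (\<Union>i\<in>I. B i) = (\<Sum>i\<in>I. sum f (B i))"
      using fin disj by (intro sum.UNION_disjoint) (auto simp: disjoint_family_on_def)
    also have "\<dots> = int d * (\<Sum>i\<in>I. sum f (B i) div int d)"
      using that(1) by (simp add: sum_distrib_left)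
    finally show ?thesis using that(2) by (simp add: mult_dvd_mono)
  qed
  then show ?thesis using B I by (simp add: zero_sum_mod_def)
qed

text \<open>The blocks are treated as single indices with the divided block sums as coordinates; the
  \<open>m\<close> blocks chosen by \<open>kemnitz m\<close> have \<open>d * m\<close> elements
  together.\<close>

lemma kemnitz_from_blocks:
  assumes K: "kemnitz m" and A: "finite A"
    and B: "\<And>i. i < 4 * m - 3 \<Longrightarrow> B i \<subseteq> A \<and> card (B i) = d \<and> zero_sum_mod d a b (B i)"
    and disj: "disjoint_family_on B {..<4 * m - 3}"
  shows "\<exists>I \<subseteq> A. card I = d * m \<and> zero_sum_mod (d * m) a b I"
proof -
  obtain I where I: "I \<subseteq> {..<4 * m - 3}" "card I = m"
    "zero_sum_mod m (\<lambda>i. sum a (B i) div int d) (\<lambda>i. sum b (B i) div int d) I"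
    using K[unfolded kemnitz_def, rule_format, of "{..<4 * m - 3}"
        "\<lambda>i. sum a (B i) div int d" "\<lambda>i. sum b (B i) div int d"] by auto
  have "finite (B i)" if "i \<in> I" for i
    using B[of i] I(1) that finite_subset[OF _ A, of "B i"] by auto
  then have fin: "finite I" "\<And>i. i \<in> I \<Longrightarrow> finite (B i)"
    using I(1) finite_subset by auto
  have disjI: "disjoint_family_on B I"
    using disj I(1) by (rule disjoint_family_on_mono[rotated])
  have "zero_sum_mod (d * m) a b (\<Union>i\<in>I. B i)"
    using I B by (intro zero_sum_mod_UN_blocks[OF fin disjI]) auto
  moreover have "card (\<Union>i\<in>I. B i) = (\<Sum>i\<in>I. card (B i))"
    using fin disjI by (intro card_UN_disjoint) (auto simp: disjoint_family_on_def)
  then have "card (\<Union>i\<in>I. B i) = d * m"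
    using B I(1,2) by (simp add: subset_eq mult.commute)
  moreover have "(\<Union>i\<in>I. B i) \<subseteq> A" using B I(1) by auto
  ultimately show ?thesis by blast
qed

lemma kemnitz_mult:
  assumes "kemnitz d" "kemnitz m" "m \<ge> 1"
  shows "kemnitz (d * m)"
  unfolding kemnitz_def
proof (intro allI impI)
  fix A :: "nat set" and a b :: "nat \<Rightarrow> int"
  assume A: "finite A \<and> 4 * (d * m) - 3 \<le> card A"
  \<comment> \<open>Hence \<open>4 * (d * m) - 3\<close> is exactly the size that
    \<open>kemnitz_blocks\<close> asks for to supply \<open>4 * m - 3\<close> blocks.\<close>
  have "(4 * m - 3) * d + 3 * d = 4 * (d * m)"
    using assms(3) by (simp add: algebra_simps diff_mult_distrib)
  then obtain B where B: "\<forall>i<4 * m - 3. B i \<subseteq> A \<and> card (B i) = d \<and> zero_sum_mod d a b (B i)"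
    "disjoint_family_on B {..<4 * m - 3}"
    using kemnitz_blocks[OF assms(1), of A "4 * m - 3" a b] A by auto
  then show "\<exists>I \<subseteq> A. card I = d * m \<and> zero_sum_mod (d * m) a b I"
    using A by (intro kemnitz_from_blocks[OF assms(2), of A B]) auto
qed

text \<open>Kemnitz modulo \<open>d\<close> splits \<open>3 * m - 3\<close> blocks off
  \<open>A\<close>. The \<open>3 * d - 3\<close> indices left over, together with \<open>c\<close>,
  contain one more block, of weight \<open>d\<close> or \<open>2 * d\<close>, which acts as the
  exceptional index when the property for \<open>m\<close> is applied to the blocks.\<close>

lemma weighted_egz_mult:
  assumes W: "weighted_egz d" "weighted_egz m" and K: "kemnitz d" and pos: "d \<ge> 1" "m \<ge> 1"
  shows "weighted_egz (d * m)"
  unfolding weighted_egz_def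
proof (intro allI impI)
  fix A :: "nat set" and c and a b h :: "nat \<Rightarrow> int"
  assume *: "finite A \<and> card A = 3 * (d * m) - 3 \<and> c \<notin> A \<and> (\<forall>i\<in>A. h i = 1) \<and> (h c = 1 \<or> h c = 2)"
  define k where "k = 3 * m - 3"
  have k: "k * d + 3 * d = 3 * (d * m)"
    using pos by (simp add: k_def algebra_simps diff_mult_distrib)
  obtain B where B: "\<And>i. i < k \<Longrightarrow> B i \<subseteq> A \<and> card (B i) = d \<and> zero_sum_mod d a b (B i)"
    and disj: "disjoint_family_on B {..<k}"
    using kemnitz_blocks[OF K, of A k a b] * k by auto
  define U where "U = (\<Union>i<k. B i)"
  have U: "U \<subseteq> A" "finite U" using B * finite_subset[of U A] by (auto simp: U_def)
  have "card U = (\<Sum>i<k. card (B i))"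
    unfolding U_def using B disj *
    by (intro card_UN_disjoint) (auto simp: disjoint_family_on_def intro: finite_subset)
  then have "card U = k * d" using B by simp
  then have card_AU: "card (A - U) = 3 * d - 3"
    using U * k by (simp add: card_Diff_subset)
  then obtain J where J: "J \<subseteq> insert c (A - U)" "J \<noteq> {}" "int d dvd sum h J" "zero_sum_mod d a b J"
    using W(1)[unfolded weighted_egz_def, rule_format, of "A - U" c h a b] * by auto
  have finJ: "finite J" using J(1) * finite_subset[of J "insert c (A - U)"] by auto
  have h_pos: "h i \<ge> 1" if "i \<in> insert c A" for i using * that by auto
  have "sum h J \<ge> (\<Sum>i\<in>J. 1)" using J(1) h_pos by (intro sum_mono) auto
  moreover have "card J \<ge> 1" using J(2) finJ by (simp add: Suc_le_eq card_gt_0_iff)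
  \<comment> \<open>The index \<open>c\<close> contributes at most 2, each of the
    \<open>3 * d - 3\<close> others at most 1.\<close>
  moreover have "sum h J < 3 * int d"
  proof -
    have "sum h J \<le> sum h (insert c (A - U))"
      using J(1) * h_pos by (intro sum_mono2) (auto intro: order_trans[OF zero_le_one])
    also have "\<dots> = h c + int (card (A - U))" using * by simp
    also have "\<dots> < 3 * int d" using * card_AU pos by auto
    finally show ?thesis .
  qed
  ultimately have sum_J: "0 < sum h J" "sum h J < 3 * int d" by auto
  obtain q where q: "sum h J = int d * q" using J(3) by blast
  have "0 < q" using sum_J(1) unfolding q by (simp add: zero_less_mult_iff)
  moreover have "q < 3" using sum_J(2) pos unfolding q by (simp add: mult.commute[of 3])
  ultimately have q12: "q = 1 \<or> q = 2" by linarith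
  \<comment> \<open>The block \<open>J\<close> gets the exceptional index \<open>k\<close>, with
    \<open>q\<close> as its weight in units of \<open>d\<close>.\<close>
  define B' where "B' = B(k := J)"
  define h' where "h' = (\<lambda>_::nat. 1)(k := q)"
  obtain I where I: "I \<subseteq> insert k {..<k}" "I \<noteq> {}" "int m dvd sum h' I"
    "zero_sum_mod m (\<lambda>i. sum a (B' i) div int d) (\<lambda>i. sum b (B' i) div int d) I"
    using W(2)[unfolded weighted_egz_def, rule_format, of "{..<k}" k h'
        "\<lambda>i. sum a (B' i) div int d" "\<lambda>i. sum b (B' i) div int d"] q12
    by (auto simp: h'_def k_def)
  have B': "B' i \<subseteq> insert c A \<and> B' i \<noteq> {} \<and> zero_sum_mod d a b (B' i) \<and> sum h (B' i) = int d * h' i"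
    if i: "i \<in> I" for i
  proof (cases "i = k")
    case True
    then show ?thesis using J q by (auto simp: B'_def h'_def)
  next
    case False
    then have ik: "i < k" using i I(1) by auto
    have "sum h (B i) = (\<Sum>i\<in>B i. 1)" using B[OF ik] * by (intro sum.cong) auto
    then show ?thesis using B[OF ik] False pos by (auto simp: B'_def h'_def)
  qed
  have fin: "finite I" "\<And>i. i \<in> I \<Longrightarrow> finite (B' i)"
    using I(1) B' * finite_subset[of I "insert k {..<k}"] by (auto intro: finite_subset[of _ "insert c A"])
  have "J \<inter> U = {}" using J(1) * U by blast
  then have "disjoint_family_on B' (insert k {..<k})"
    using disjoint_family_on_fun_upd_Suc[OF disj, of J] by (simp add: U_def B'_def lessThan_Suc)
  then have disj': "disjoint_family_on B' I"
    using I(1) disjoint_family_on_mono by blast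
  have "zero_sum_mod (d * m) a b (\<Union>i\<in>I. B' i)"
    using B' I(4) by (intro zero_sum_mod_UN_blocks[OF fin disj']) auto
  moreover have "sum h (\<Union>i\<in>I. B' i) = (\<Sum>i\<in>I. sum h (B' i))"
    using fin disj' by (intro sum.UNION_disjoint) (auto simp: disjoint_family_on_def)
  then have "sum h (\<Union>i\<in>I. B' i) = int d * sum h' I"
    using B' by (simp add: sum_distrib_left)
  then have "int (d * m) dvd sum h (\<Union>i\<in>I. B' i)"
    using I(3) by (simp add: mult_dvd_mono)
  moreover have "(\<Union>i\<in>I. B' i) \<subseteq> insert c A" using B' by blast
  moreover have "(\<Union>i\<in>I. B' i) \<noteq> {}" using B' I(2) by blast
  ultimately show "\<exists>I \<subseteq> insert c A. I \<noteq> {} \<and> int (d * m) dvd sum h I \<and> zero_sum_mod (d * m) a b I"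
    by blast
qed

text \<open>Both properties hold for primes and pass to products, so splitting off one prime factor
  at a time reaches every \<open>n\<close>.\<close>

lemma kemnitz_and_weighted_egz:
  assumes "n \<ge> 1"
  shows "kemnitz n \<and> weighted_egz n"
  using assms
proof (induction n rule: less_induct)
  case (less n)
  show ?case
  proof (cases "n = 1")
    case True
    have "kemnitz 1"
      unfolding kemnitz_def
    proof (intro allI impI)
      fix A :: "nat set" and a b :: "nat \<Rightarrow> int"
      assume "finite A \<and> 4 * 1 - 3 \<le> card A"
      then obtain x where "x \<in> A" by fastforce
      then show "\<exists>I \<subseteq> A. card I = 1 \<and> zero_sum_mod 1 a b I"
        by (intro exI[of _ "{x}"]) (auto simp: zero_sum_mod_def)
    qed
    moreover have "weighted_egz 1"
      unfolding weighted_egz_def zero_sum_mod_def by auto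
    ultimately show ?thesis using True by simp
  next
    case False
    then obtain p m where pm: "prime p" "n = p * m"
      using prime_factor_nat by (metis dvdE)
    then have "m \<ge> 1" "m < n" using less.prems prime_gt_1_nat[OF pm(1)] by (auto simp: Suc_le_eq)
    then show ?thesis
      using less.IH[of m] kemnitz_mult[of p m] weighted_egz_mult[of p m] kemnitz_prime[OF pm(1)]
        weighted_egz_prime[OF pm(1)] pm prime_ge_1_nat[OF pm(1)] by simp
  qed
qed

section \<open>Zero-sum index sets of size \<open>4 * n - j\<close> with \<open>j\<close> dividing
  \<open>n\<close>\<close>

lemma zero_sum_of_size_n_in_4n_minus_divisor:
  fixes A :: "nat set"
  assumes n: "n \<ge> 1" "j dvd n" and A: "finite A" "card A = 4 * n - j" "zero_sum_mod n a b A"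
  shows "\<exists>I \<subseteq> A. card I = n \<and> zero_sum_mod n a b I"
proof -
  obtain m where m: "n = j * m" using n(2) by blast
  then have pos: "j \<ge> 1" "m \<ge> 1" using n(1) by (auto simp: Suc_le_eq)
  \<comment> \<open>One block fewer than \<open>kemnitz_from_blocks\<close> needs; exactly
    \<open>3 * j\<close> indices are left over.\<close>
  define k where "k = 4 * m - 4"
  have k: "k * j + 3 * j = 4 * n - j" "Suc k = 4 * m - 3"
    using pos by (simp_all add: k_def m algebra_simps diff_mult_distrib)
  obtain B where B: "\<And>i. i < k \<Longrightarrow> B i \<subseteq> A \<and> card (B i) = j \<and> zero_sum_mod j a b (B i)"
    and disj: "disjoint_family_on B {..<k}"
  proof -
    have "k * j + 3 * j - 3 \<le> card A" using A(2) k(1) by linarith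
    then show ?thesis
      using kemnitz_blocks[of j A k a b] kemnitz_and_weighted_egz[OF pos(1)] A(1) that by blast
  qed
  define U where "U = (\<Union>i<k. B i)"
  have U: "U \<subseteq> A" "finite U" using B A(1) finite_subset[of U A] by (auto simp: U_def)
  have finB: "finite (B i)" if "i < k" for i
    using B[OF that] A(1) finite_subset by blast
  have "card U = (\<Sum>i<k. card (B i))"
    unfolding U_def using finB disj
    by (intro card_UN_disjoint) (auto simp: disjoint_family_on_def)
  then have "card U = k * j" using B by simp
  then have "card (A - U) = 3 * j"
    using U A k by (simp add: card_Diff_subset)
  \<comment> \<open>With cofactor 1 the condition on the divided sums is trivial.\<close>
  moreover have "zero_sum_mod j a b U"
    using zero_sum_mod_UN_blocks[of "{..<k}" B j a b 1] finB disj B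
    by (simp add: U_def zero_sum_mod_def)
  moreover have "zero_sum_mod j a b A"
    using A(3) n(2) unfolding zero_sum_mod_def by (metis dvd_trans int_dvd_int_iff)
  ultimately obtain J where J: "J \<subseteq> A - U" "card J = j" "zero_sum_mod j a b J"
    using zero_sum_of_size_3n[of j "A - U" a b] zero_sum_mod_Diff[OF A(1) U(1)]
      kemnitz_and_weighted_egz[OF pos(1)] pos(1) A(1) by auto
  have "disjoint_family_on (B(k := J)) {..<Suc k}"
    using disj J(1) by (intro disjoint_family_on_fun_upd_Suc) (auto simp: U_def)
  moreover have "(B(k := J)) i \<subseteq> A \<and> card ((B(k := J)) i) = j \<and> zero_sum_mod j a b ((B(k := J)) i)"
    if "i < Suc k" for i
    using B J that by (auto simp: less_Suc_eq)
  ultimately show ?thesis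
    using kemnitz_from_blocks[of m A "B(k := J)" j a b] kemnitz_and_weighted_egz[OF pos(2)] A(1)
    unfolding k(2) m by blast
qed

section \<open>From sequences over the group to index sets\<close>

lemma zero_sum_integer_mod_group_square:
  "zero_sum (integer_mod_group n \<times>\<times> integer_mod_group n) xs \<longleftrightarrow>
    int n dvd sum_list (map fst xs) \<and> int n dvd sum_list (map snd xs)"
proof -
  let ?G = "integer_mod_group n \<times>\<times> integer_mod_group n"
  have "foldr (\<otimes>\<^bsub>?G\<^esub>) xs \<one>\<^bsub>?G\<^esub> = (sum_list (map fst xs) mod int n, sum_list (map snd xs) mod int n)"
    by (induction xs) (auto simp: DirProd_def mod_simps)
  then show ?thesis by (simp add: zero_sum_def DirProd_def dvd_eq_mod_eq_0)
qed

lemma sum_list_map_nths: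
  fixes f :: "'a \<Rightarrow> 'b::comm_monoid_add"
  assumes "I \<subseteq> {..<length xs}"
  shows "sum_list (map f (nths xs I)) = (\<Sum>i\<in>I. f (xs ! i))"
  using assms
proof (induction xs arbitrary: I rule: rev_induct)
  case (snoc x xs)
  let ?J = "I - {length xs}"
  have J: "?J \<subseteq> {..<length xs}" using snoc.prems by auto
  have nths_eq: "nths xs I = nths xs ?J"
    unfolding nths_def by (intro arg_cong[of _ _ "map fst"] filter_cong) (auto simp: set_zip)
  have "(\<Sum>i\<in>?J. f ((xs @ [x]) ! i)) = (\<Sum>i\<in>?J. f (xs ! i))"
    using J by (intro sum.cong) (auto simp: nth_append)
  then have IH: "sum_list (map f (nths xs I)) = (\<Sum>i\<in>?J. f ((xs @ [x]) ! i))"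
    using snoc.IH[OF J] nths_eq by simp
  have finI: "finite I" using snoc.prems finite_subset by blast
  show ?case
  proof (cases "length xs \<in> I")
    case True
    then show ?thesis
      using IH finI by (simp add: nths_append sum.remove[of I "length xs"] add.commute)
  next
    case False
    then show ?thesis using IH by (simp add: nths_append)
  qed
qed simp

text \<open>Addressing subsequences by sets of positions keeps repeated terms apart and makes the
  results on index sets applicable to lists.\<close>

lemma zero_sum_nths:
  assumes "I \<subseteq> {..<length xs}"
  shows "zero_sum (integer_mod_group n \<times>\<times> integer_mod_group n) (nths xs I) \<longleftrightarrow>
    zero_sum_mod n (\<lambda>i. fst (xs ! i)) (\<lambda>i. snd (xs ! i)) I"
  using assms by (simp add: zero_sum_integer_mod_group_square sum_list_map_nths zero_sum_mod_def)

lemma forces_zero_sum_integer_mod_group_square: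
  assumes n: "n \<ge> 1" and div: "\<And>j. 4 \<le> j \<Longrightarrow> j < l \<Longrightarrow> j dvd n" and l: "l \<ge> 4"
  shows "forces_zero_sum (integer_mod_group n \<times>\<times> integer_mod_group n) n (4 * n - l + 1)"
  unfolding forces_zero_sum_def
proof (intro allI impI, elim conjE)
  let ?G = "integer_mod_group n \<times>\<times> integer_mod_group n"
  fix xs
  assume zs: "zero_sum ?G xs" and len: "4 * n - l + 1 \<le> length xs"
  let ?A = "{..<length xs}" and ?a = "\<lambda>i. fst (xs ! i)" and ?b = "\<lambda>i. snd (xs ! i)"
  have "\<exists>I \<subseteq> ?A. card I = n \<and> zero_sum_mod n ?a ?b I"
  proof (cases "4 * n - 3 \<le> length xs")
    case True
    then show ?thesis
      using kemnitz_and_weighted_egz[OF n] unfolding kemnitz_def by auto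
  next
    case False
    have "nths xs ?A = xs" by (rule nths_all) simp
    then have "zero_sum_mod n ?a ?b ?A"
      using zs zero_sum_nths[of ?A xs n] by simp
    \<comment> \<open>The deficit \<open>4 * n - length xs\<close> is at least 4 as the Kemnitz
      range is missed, and below \<open>l\<close> by the length bound.\<close>
    moreover have "4 * n - length xs dvd n"
      using False len l by (intro div) linarith+
    moreover have "card ?A = 4 * n - (4 * n - length xs)"
      using False by simp
    ultimately show ?thesis
      using zero_sum_of_size_n_in_4n_minus_divisor[OF n, of "4 * n - length xs" ?A ?a ?b] by simp
  qed
  then obtain I where I: "I \<subseteq> ?A" "card I = n" "zero_sum_mod n ?a ?b I" by blast
  have "{i. i < length xs \<and> i \<in> I} = I" using I(1) by auto
  then have "length (nths xs I) = n" using I(2) by (simp add: length_nths)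
  then show "\<exists>ys. subseq ys xs \<and> length ys = n \<and> zero_sum ?G ys"
    using I zero_sum_nths[OF I(1)] subseq_conv_nths by blast
qed

section \<open>The extremal sequence for the lower bound\<close>

lemma subseq_replicate_imp:
  assumes "subseq ys (replicate k x)"
  shows "\<exists>m\<le>k. ys = replicate m x"
proof -
  have "\<forall>y\<in>set ys. y = x" using assms by (auto simp: subseq_conv_nths dest: in_set_nthsD)
  then have "ys = replicate (length ys) x" by (simp add: replicate_length_same)
  moreover have "length ys \<le> k" using list_emb_length[OF assms] by simp
  ultimately show ?thesis by blast
qed

lemma not_forces_zero_sum_integer_mod_group_square:
  assumes n: "n \<ge> 1" and l: "l \<ge> 4" "\<not> l dvd n" "l \<le> n + 3" and L: "L \<le> 4 * n - l"
  shows "\<not> forces_zero_sum (integer_mod_group n \<times>\<times> integer_mod_group n) n L"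
proof
  let ?G = "integer_mod_group n \<times>\<times> integer_mod_group n"
  assume forces: "forces_zero_sum ?G n L"
  \<comment> \<open>\<open>g\<close> is a multiple of \<open>gcd l n\<close> so that the congruence
    for \<open>t\<close> is solvable, at least 2 so that \<open>(t+1,t+1)\<close> occurs fewer than
    \<open>n\<close> times, and at most \<open>l - 2\<close> so that \<open>(t,t)\<close>
    does.\<close>
  define g where "g = max 2 (gcd l n)"
  have g2: "g \<ge> 2" by (simp add: g_def)
  have gl: "g + 2 \<le> l"
  proof -
    \<comment> \<open>As \<open>l\<close> does not divide \<open>n\<close>, the gcd is a proper
      divisor of \<open>l\<close> and so at most half of it.\<close>
    obtain q where q: "l = gcd l n * q" by (meson dvdE gcd_dvd1)
    have "gcd l n \<noteq> l" using l(2) by (metis gcd_dvd2)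
    moreover have "q \<noteq> 0" using q l(1) by (intro notI) simp
    ultimately have "q \<ge> 2" using q by (cases "q = 1") auto
    then have "gcd l n * 2 \<le> l" using q by (metis mult_le_mono2)
    then show ?thesis using l(1) by (auto simp: g_def)
  qed
  have "gcd l n dvd g"
  proof (cases "gcd l n = 1")
    case False
    moreover have "gcd l n > 0" using n by simp
    ultimately have "gcd l n \<ge> 2" by linarith
    then show ?thesis by (simp add: g_def max_def)
  qed simp
  then have "gcd (int l) (int n) dvd - int g" by (simp add: gcd_int_int_eq)
  then obtain t where t: "[int l * t = - int g] (mod int n)"
    using cong_solve_dvd_int by blast
  define P where "P u v = ((t + u) mod int n, (t + v) mod int n)" for u v
  define X where "X x0 x1 x2 x3 = replicate x0 (P 0 0) @ replicate x1 (P 1 0) @ replicate x2 (P 0 1) @ replicate x3 (P 1 1)"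
    for x0 x1 x2 x3
  have zs_X: "zero_sum ?G (X x0 x1 x2 x3) \<longleftrightarrow>
      int n dvd int (x0 + x1 + x2 + x3) * t + int (x1 + x3) \<and> int n dvd int (x0 + x1 + x2 + x3) * t + int (x2 + x3)"
    for x0 x1 x2 x3
  proof -
    have "[int x0 * (t mod int n) + (int x1 * ((t + 1) mod int n) + (int x2 * (t mod int n) + int x3 * ((t + 1) mod int n)))
        = int x0 * t + (int x1 * (t + 1) + (int x2 * t + int x3 * (t + 1)))] (mod int n)"
      "[int x0 * (t mod int n) + (int x1 * (t mod int n) + (int x2 * ((t + 1) mod int n) + int x3 * ((t + 1) mod int n)))
        = int x0 * t + (int x1 * t + (int x2 * (t + 1) + int x3 * (t + 1)))] (mod int n)"
      by (intro cong_add cong_mult cong_refl; simp add: cong_def)+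
    then show ?thesis
      unfolding zero_sum_integer_mod_group_square X_def
      by (simp add: P_def sum_list_replicate cong_dvd_iff algebra_simps)
  qed
  define xs where "xs = X (n + g + 1 - l) (n - 1) (n - 1) (n + 1 - g)"
  \<comment> \<open>The bounds ensure that none of the subtractions of naturals is truncated; they
    rest on \<open>l \<le> n + 3\<close>.\<close>
  have total: "(n + g + 1 - l) + (n - 1) + (n - 1) + (n + 1 - g) = 4 * n - l"
    "l \<le> n + g + 1" "g \<le> n + 1" "l \<le> 4 * n"
    using n l gl g2 by linarith+
  have "set xs \<subseteq> carrier ?G"
    using n by (auto simp: xs_def X_def P_def DirProd_def carrier_integer_mod_group)
  moreover have "length xs = 4 * n - l"
    using total(1) by (simp add: xs_def X_def)
  moreover have "zero_sum ?G xs"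
  proof -
    have "int n dvd int l * t + int g"
      using t by (simp add: cong_iff_dvd_diff)
    \<comment> \<open>Both coordinates of the total are
      \<open>(4 * n - l) * t + (2 * n - g)\<close>, which differs from \<open>-(l * t + g)\<close>
      by a multiple of \<open>n\<close>.\<close>
    then have "int n dvd (4 * t + 2) * int n - (int l * t + int g)"
      by (intro dvd_diff) auto
    moreover have "(4 * t + 2) * int n - (int l * t + int g) = int (4 * n - l) * t + int ((n - 1) + (n + 1 - g))"
      using total n by (simp add: of_nat_diff algebra_simps)
    ultimately show ?thesis
      unfolding xs_def zs_X total(1) by (simp only:)
  qed
  ultimately obtain ys where ys: "subseq ys xs" "length ys = n" "zero_sum ?G ys"
    using forces[unfolded forces_zero_sum_def, rule_format, of xs] L by auto
  obtain y0 y1 y2 y3 where y: "ys = y0 @ y1 @ y2 @ y3"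
    "subseq y0 (replicate (n + g + 1 - l) (P 0 0))" "subseq y1 (replicate (n - 1) (P 1 0))"
    "subseq y2 (replicate (n - 1) (P 0 1))" "subseq y3 (replicate (n + 1 - g) (P 1 1))"
    using ys(1) unfolding xs_def X_def subseq_append_iff by blast
  obtain x0 x1 x2 x3 where x: "ys = X x0 x1 x2 x3"
    and le: "x0 \<le> n + g + 1 - l" "x1 \<le> n - 1" "x2 \<le> n - 1" "x3 \<le> n + 1 - g"
    using y(2-5)[THEN subseq_replicate_imp] unfolding y(1) X_def by blast
  have sum: "x0 + x1 + x2 + x3 = n" using ys(2) by (simp add: x X_def)
  \<comment> \<open>With exactly \<open>n\<close> terms the common offset \<open>t\<close>
    contributes a multiple of \<open>n\<close>.\<close>
  have "n dvd x1 + x3" "n dvd x2 + x3"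
    using ys(3) unfolding x zs_X sum by (simp_all add: dvd_add_right_iff flip: of_nat_add)
  then obtain q r where qr: "x1 + x3 = n * q" "x2 + x3 = n * r" by (auto elim!: dvdE)
  \<comment> \<open>Each of the two sums is at most
    \<open>(n - 1) + (n + 1 - g) = 2 * n - g\<close>.\<close>
  have "n * q < n * 2" "n * r < n * 2" using qr le g2 n by linarith+
  then have "q = 0 \<or> q = 1" "r = 0 \<or> r = 1" by auto
  then have "x1 + x3 = 0 \<or> x1 + x3 = n" "x2 + x3 = 0 \<or> x2 + x3 = n" using qr by auto
  \<comment> \<open>The four cases force one of \<open>x0\<close>, \<open>x1\<close>,
    \<open>x2\<close>, \<open>x3\<close> to be \<open>n\<close>, and each is bounded by
    \<open>n - 1\<close>.\<close>
  then show False using sum le gl g2 n by linarith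
qed

theorem theorem1p4:
  fixes n l :: nat
  assumes "n \<ge> 1"
    and "l = (LEAST m. m \<ge> 4 \<and> \<not> m dvd n)"
  shows "modified_EGZ (integer_mod_group n \<times>\<times> integer_mod_group n) n = enat (4 * n - l + 1)"
proof -
  let ?G = "integer_mod_group n \<times>\<times> integer_mod_group n"
  \<comment> \<open>The witness \<open>n + 3\<close> exceeds \<open>n\<close> and is at least 4, so
    the minimum exists and is at most \<open>n + 3\<close>.\<close>
  have ex: "n + 3 \<ge> 4 \<and> \<not> n + 3 dvd n"
    using assms(1) by (auto dest: dvd_imp_le)
  have l: "l \<ge> 4 \<and> \<not> l dvd n" "l \<le> n + 3"
    unfolding assms(2) by (rule LeastI[of "\<lambda>m. m \<ge> 4 \<and> \<not> m dvd n", OF ex],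
      rule Least_le[of "\<lambda>m. m \<ge> 4 \<and> \<not> m dvd n", OF ex])
  have div: "j dvd n" if "4 \<le> j" "j < l" for j
    using not_less_Least[of j "\<lambda>m. m \<ge> 4 \<and> \<not> m dvd n"] that assms(2) by blast
  have "4 * n - l + 1 \<le> L" if "forces_zero_sum ?G n L" for L
    using not_forces_zero_sum_integer_mod_group_square[OF assms(1) _ _ l(2), of L] l(1) that
    by (cases "L \<le> 4 * n - l") auto
  moreover have "forces_zero_sum ?G n (4 * n - l + 1)"
    using forces_zero_sum_integer_mod_group_square[OF assms(1) div] l(1) by blast
  ultimately show ?thesis
    unfolding modified_EGZ_def by (intro antisym INF_lower INF_greatest) auto
qed

end
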